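(* Let $S$ be a decision space and $J:S\to\mathbb{R}$ a cost function such that: $S$ has bounded volume ($\int_S 1\,ds<\infty$) or $S$ has finitely many elements, and there exist $m,M\in\mathbb{R}$ with $m\le J(s)\le M$ for all $s\in S$. Let $J^*=\min_{s\in S}J(s)$ and let $G(s)=J(s)-J^*$ be the optimality gap of $s\in S$. Let $I_1=\{(s_i,J(s_i))\}_{i=1}^{N_p}$ be a set of $N_p$ decisions and costs, the decisions $s_i$ being sampled independently from the uniform distribution $\mathrm{U}[S]$, and let $s^*_{N_p}$ be a (perhaps non-unique) sampled decision with minimum sampled cost. Let $D\subseteq I_1$ be nonempty and let $\mathbb{V}:S\to\mathbb{R}$ be the variance function $\mathbb{V}(s)=\min_{s_i\in D}|J(s)-J(s_i)|$. For $r\in\mathbb{R}$ let $\Omega_r=\{s\in S : \mathbb{V}(s)\le r\}$. Assume (fairness) $$\mathcal{V}\bigl(S\setminus\Omega_{G(s^*_{N_p})}\bigr)>0,$$ where $\mathcal{V}(A)$ denotes the volume fraction of $S$ occupied by $A\subseteq S$, and let $p>0$ satisfy $$\mathbb{P}_{\mathrm{U}[S]}\bigl[S\setminus\Omega_{G(s^*_{N_p})}\bigr]=p.$$ Let $I_2=\{(s_i',\mathbb{V}(s_i'))\}_{i=1}^{N_v}$ be a set of $N_v$ decisions $s_i'$ independently sampled from $\mathrm{U}[S]$ together with their variances, and let $\mathbb{V}^*_{N_v}=\max_{1\le i\le N_v}\mathbb{V}(s_i')$ be the maximum sampled variance. Then for all $\epsilon\in[0,p]$, $$\mathbb{P}^{N_v}_{\mathrm{U}[S]}\bigl[\mathbb{V}^*_{N_v}\ge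 G(s^*_{N_p})\bigr]\ge 1-(1-\epsilon)^{N_v}.$$
   Context: $N_p$ and $N_v$ are positive integers. The volume fraction of $A\subseteq S$ is $\mathcal{V}(A)=\int_A 1\,ds\big/\int_S 1\,ds$ (for finite $S$: $|A|/|S|$). $\mathrm{U}[S]$ is the uniform distribution on $S$, which gives $A\subseteq S$ probability $\mathcal{V}(A)$. In the continuous case $S$ is a Borel subset of some $\mathbb{R}^n$ with positive finite Lebesgue measure and $J$ is Borel measurable; in the finite case $S$ is nonempty. The minimum $J^*$ is assumed to be attained. Writing $s_i\in D$ means that the pair $(s_i,J(s_i))$ belongs to $D$. The first sample set $I_1$ (hence $s^*_{N_p}$, $D$, $\mathbb{V}$ and $p$) is regarded as already drawn and fixed; $\mathbb{P}^{N_v}_{\mathrm{U}[S]}$ is the product probability over the $N_v$ independent uniform draws $s_1',\dots,s_{N_v}'$, independent of $I_1$. *)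

theory Defs
  imports "HOL-Probability.Probability"
begin

text \<open>
  A decision space \<open>S\<close> is represented by a reference measure \<open>\<mu>\<close> with \<open>space \<mu> = S\<close>:
  \<open>count_space S\<close> for finite \<open>S\<close>, and \<open>restrict_space lborel S\<close> for a Borel subset \<open>S\<close> of a
  Euclidean space. Cost functions are total on the type; only their values on \<open>S\<close> matter.
\<close>

definition volume_fraction :: "'a measure \<Rightarrow> 'a set \<Rightarrow> real" where
  "volume_fraction \<mu> A = measure \<mu> A / measure \<mu> (space \<mu>)"

definition unif :: "'a measure \<Rightarrow> 'a measure" where
  "unif \<mu> = uniform_measure \<mu> (space \<mu>)"

lemma volume_fraction_count_space:
  assumes "finite S" "A \<subseteq> S"
  shows "volume_fraction (count_space S) A = card A / card S"
  using assms by (simp add: volume_fraction_def measure_count_space finite_subset)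

lemma volume_fraction_restrict_lborel:
  assumes "S \<in> sets borel" "A \<subseteq> S"
  shows "volume_fraction (restrict_space lborel S) A = measure lborel A / measure lborel S"
  using assms by (simp add: volume_fraction_def measure_restrict_space space_restrict_space)

lemma measure_unif:
  assumes "0 < emeasure \<mu> (space \<mu>)" "emeasure \<mu> (space \<mu>) < \<infinity>" "A \<in> sets \<mu>"
  shows "measure (unif \<mu>) A = volume_fraction \<mu> A"
  using assms sets.sets_into_space[OF assms(3)]
  by (simp add: unif_def volume_fraction_def measure_uniform_measure Int_absorb1)

text \<open>The minimum is the least attained cost; it is meaningful only if the minimum is attained.\<close>

definition min_cost :: "'a set \<Rightarrow> ('a \<Rightarrow> real) \<Rightarrow> real" where
  "min_cost S J = (LEAST c. c \<in> J ` S)"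

definition optimality_gap :: "'a set \<Rightarrow> ('a \<Rightarrow> real) \<Rightarrow> 'a \<Rightarrow> real" where
  "optimality_gap S J s = J s - min_cost S J"

definition sampled_costs :: "('a \<Rightarrow> real) \<Rightarrow> nat \<Rightarrow> (nat \<Rightarrow> 'a) \<Rightarrow> ('a \<times> real) set" where
  "sampled_costs J N s = (\<lambda>i. (s i, J (s i))) ` {1..N}"

text \<open>Here \<open>D\<close> is a finite nonempty set of pairs of the form \<open>(x, J x)\<close>.\<close>

definition variance_fun :: "('a \<Rightarrow> real) \<Rightarrow> ('a \<times> real) set \<Rightarrow> 'a \<Rightarrow> real" where
  "variance_fun J D s = (MIN x\<in>{x. (x, J x) \<in> D}. \<bar>J s - J x\<bar>)"

definition variance_sublevel ::
    "'a set \<Rightarrow> ('a \<Rightarrow> real) \<Rightarrow> ('a \<times> real) set \<Rightarrow> real \<Rightarrow> 'a set" where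
  "variance_sublevel S J D r = {s \<in> S. variance_fun J D s \<le> r}"

definition max_sampled_variance ::
    "('a \<Rightarrow> real) \<Rightarrow> ('a \<times> real) set \<Rightarrow> nat \<Rightarrow> (nat \<Rightarrow> 'a) \<Rightarrow> real" where
  "max_sampled_variance J D N t = (MAX i\<in>{1..N}. variance_fun J D (t i))"

text \<open>The joint law of \<open>N\<close> independent uniform draws, indexed by \<open>{1..N}\<close>.\<close>

definition unif_samples :: "'a measure \<Rightarrow> nat \<Rightarrow> (nat \<Rightarrow> 'a) measure" where
  "unif_samples \<mu> N = PiM {1..N} (\<lambda>_. unif \<mu>)"

end

theory Submission imports Defs begin

text \<open>
  The maximum over the draws stays below a threshold iff every single draw does, so by
  independence this has probability \<open>q ^ N\<close>, where \<open>q\<close> is the probability that one draw stays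
  below. For the optimality gap as threshold, fairness gives \<open>q \<le> 1 - p \<le> 1 - \<epsilon>\<close>.
\<close>

lemma sets_unif: "sets (unif \<mu>) = sets \<mu>"
  by (simp add: unif_def)

lemma space_unif: "space (unif \<mu>) = space \<mu>"
  by (simp add: unif_def)

lemma prob_space_unif:
  assumes "0 < emeasure \<mu> (space \<mu>)" "emeasure \<mu> (space \<mu>) < \<infinity>"
  shows "prob_space (unif \<mu>)"
  unfolding unif_def using assms by (intro prob_space_uniform_measure) auto

text \<open>The points over which the minimum runs are first components of elements of the finite
  set \<open>D\<close>, so the function is a minimum of finitely many measurable functions.\<close>

lemma measurable_variance_fun:
  assumes J: "J \<in> borel_measurable \<mu>" and D: "finite D"
  shows "variance_fun J D \<in> borel_measurable \<mu>"
proof -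
  have "{x. (x, J x) \<in> D} \<subseteq> fst ` D"
    by force
  then have "finite {x. (x, J x) \<in> D}"
    using D finite_surj by blast
  then show ?thesis
    unfolding variance_fun_def[abs_def] using J by (intro borel_measurable_Min) auto
qed

lemma finite_sampled_costs: "finite (sampled_costs J N s)"
  by (simp add: sampled_costs_def)

text \<open>The complement of the event is a box with the same side \<open>B\<close> in every
  coordinate, and the product measure of a box is the product of its side measures. No loss occurs
  here: the inequality of the theorem comes only from the later bound on one draw.\<close>

lemma prob_PiM_Max_ge:
  fixes f :: "'a \<Rightarrow> 'b :: {linorder_topology, second_countable_topology}"
  assumes P: "prob_space P" and f: "f \<in> borel_measurable P"
    and I: "finite I" "I \<noteq> {}"
  shows "measure (PiM I (\<lambda>_. P)) {t \<in> space (PiM I (\<lambda>_. P)). (MAX i\<in>I. f (t i)) \<ge> r}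
    = 1 - measure P {x \<in> space P. f x < r} ^ card I"
proof -
  interpret P: prob_space P by fact
  interpret PP: product_prob_space "\<lambda>_. P" I by unfold_locales
  interpret FP: finite_product_prob_space "\<lambda>_. P" I by unfold_locales fact
  define B where "B = {x \<in> space P. f x < r}"
  have B: "B \<in> sets P"
    unfolding B_def using f by measurable
  have "(MAX i\<in>I. f (t i)) \<ge> r \<longleftrightarrow> t \<notin> (\<Pi>\<^sub>E i\<in>I. B)"
    if "t \<in> space (PiM I (\<lambda>_. P))" for t
  proof -
    \<comment> \<open>Points of the product space are already extensional with coordinates in
      \<open>space P\<close>, so membership in the box leaves only the inequalities to
      check.\<close>
    have "t \<in> (\<Pi>\<^sub>E i\<in>I. B) \<longleftrightarrow> (\<forall>i\<in>I. f (t i) < r)"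
      using that unfolding space_PiM PiE_iff B_def by blast
    \<comment> \<open>Nonemptiness of \<open>I\<close> matters here, since \<open>Max\<close> of the
      empty set is unspecified.\<close>
    also have "\<dots> \<longleftrightarrow> (MAX i\<in>I. f (t i)) < r"
      using I by simp
    finally show ?thesis
      by (simp add: not_less)
  qed
  then have "{t \<in> space (PiM I (\<lambda>_. P)). (MAX i\<in>I. f (t i)) \<ge> r}
      = space (PiM I (\<lambda>_. P)) - (\<Pi>\<^sub>E i\<in>I. B)"
    by blast
  then have "measure (PiM I (\<lambda>_. P)) {t \<in> space (PiM I (\<lambda>_. P)). (MAX i\<in>I. f (t i)) \<ge> r}
      = 1 - measure (PiM I (\<lambda>_. P)) (\<Pi>\<^sub>E i\<in>I. B)"
    using B I by (simp add: PP.prob_compl sets_PiM_I_finite)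
  also have "\<dots> = 1 - measure P B ^ card I"
    using B by (simp add: FP.prob_times)
  finally show ?thesis
    by (simp add: B_def)
qed

text \<open>Common core of the finite and the continuous case: \<open>\<mu>\<close> stands for
  counting or restricted Lebesgue measure, and \<open>r\<close> for the optimality gap, a constant
  once the first sample is fixed.\<close>

lemma prob_max_sampled_variance_ge:
  assumes \<mu>: "0 < emeasure \<mu> (space \<mu>)" "emeasure \<mu> (space \<mu>) < \<infinity>"
    and J: "J \<in> borel_measurable \<mu>" and D: "finite D" and N: "N > 0"
    and \<epsilon>: "\<epsilon> \<le> measure (unif \<mu>) (space \<mu> - variance_sublevel (space \<mu>) J D r)"
  shows "measure (unif_samples \<mu> N)
      {t \<in> space (unif_samples \<mu> N). max_sampled_variance J D N t \<ge> r} \<ge> 1 - (1 - \<epsilon>) ^ N"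
proof -
  interpret prob_space "unif \<mu>"
    using \<mu> by (rule prob_space_unif)
  have V\<mu>: "variance_fun J D \<in> borel_measurable \<mu>"
    using J D by (rule measurable_variance_fun)
  then have V: "variance_fun J D \<in> borel_measurable (unif \<mu>)"
    by (simp add: measurable_cong_sets[OF sets_unif refl])
  have sub: "variance_sublevel (space \<mu>) J D r \<in> events"
    unfolding variance_sublevel_def sets_unif using V\<mu> by measurable
  \<comment> \<open>The maximum misses \<open>r\<close> when all draws are strictly below it,
    whereas the sublevel set is non-strict; only this inclusion is needed.\<close>
  have "prob {x \<in> space (unif \<mu>). variance_fun J D x < r}
      \<le> prob (variance_sublevel (space \<mu>) J D r)"
    using sub by (intro finite_measure_mono) (auto simp: variance_sublevel_def space_unif)
  also have "\<dots> \<le> 1 - \<epsilon>"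
    using \<epsilon> prob_compl[OF sub] by (simp add: space_unif)
  \<comment> \<open>Taking powers preserves the order because the smaller base is a probability,
    hence nonnegative.\<close>
  finally have "prob {x \<in> space (unif \<mu>). variance_fun J D x < r} ^ N \<le> (1 - \<epsilon>) ^ N"
    by (intro power_mono) auto
  then show ?thesis
    unfolding unif_samples_def max_sampled_variance_def
    using prob_PiM_Max_ge[OF prob_space_axioms V, of "{1..N}" r] N by simp
qed

theorem theorem2:
  fixes Np Nv :: nat
  assumes "Np > 0" and "Nv > 0"
  shows "(\<forall>(S :: 'a set) J m M s sstar D p \<epsilon>.
        finite S \<longrightarrow> S \<noteq> {} \<longrightarrow>
        (\<forall>x\<in>S. m \<le> J x \<and> J x \<le> M) \<longrightarrow>
        (\<exists>x\<in>S. \<forall>y\<in>S. J x \<le> J y) \<longrightarrow>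
        s \<in> {1..Np} \<rightarrow> S \<longrightarrow>
        is_arg_min J (\<lambda>x. x \<in> s ` {1..Np}) sstar \<longrightarrow>
        D \<subseteq> sampled_costs J Np s \<longrightarrow> D \<noteq> {} \<longrightarrow>
        volume_fraction (count_space S)
          (S - variance_sublevel S J D (optimality_gap S J sstar)) > 0 \<longrightarrow>
        p > 0 \<longrightarrow>
        measure (unif (count_space S))
          (S - variance_sublevel S J D (optimality_gap S J sstar)) = p \<longrightarrow>
        \<epsilon> \<in> {0..p} \<longrightarrow>
        measure (unif_samples (count_space S) Nv)
          {t \<in> space (unif_samples (count_space S) Nv).
             max_sampled_variance J D Nv t \<ge> optimality_gap S J sstar}
          \<ge> 1 - (1 - \<epsilon>) ^ Nv) \<and>
     (\<forall>(S :: 'b::euclidean_space set) J m M s sstar D p \<epsilon>.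
        S \<in> sets borel \<longrightarrow>
        0 < emeasure lborel S \<longrightarrow> emeasure lborel S < \<infinity> \<longrightarrow>
        J \<in> borel_measurable (restrict_space borel S) \<longrightarrow>
        (\<forall>x\<in>S. m \<le> J x \<and> J x \<le> M) \<longrightarrow>
        (\<exists>x\<in>S. \<forall>y\<in>S. J x \<le> J y) \<longrightarrow>
        s \<in> {1..Np} \<rightarrow> S \<longrightarrow>
        is_arg_min J (\<lambda>x. x \<in> s ` {1..Np}) sstar \<longrightarrow>
        D \<subseteq> sampled_costs J Np s \<longrightarrow> D \<noteq> {} \<longrightarrow>
        volume_fraction (restrict_space lborel S)
          (S - variance_sublevel S J D (optimality_gap S J sstar)) > 0 \<longrightarrow>
        p > 0 \<longrightarrow>
        measure (unif (restrict_space lborel S))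
          (S - variance_sublevel S J D (optimality_gap S J sstar)) = p \<longrightarrow>
        \<epsilon> \<in> {0..p} \<longrightarrow>
        measure (unif_samples (restrict_space lborel S) Nv)
          {t \<in> space (unif_samples (restrict_space lborel S) Nv).
             max_sampled_variance J D Nv t \<ge> optimality_gap S J sstar}
          \<ge> 1 - (1 - \<epsilon>) ^ Nv)"
proof (intro conjI allI impI, goal_cases)
  case (1 S J m M s sstar D p \<epsilon>)
  have "finite D"
    using \<open>D \<subseteq> sampled_costs J Np s\<close> finite_sampled_costs finite_subset by blast
  moreover have "0 < emeasure (count_space S) S" "emeasure (count_space S) S < \<infinity>"
    using \<open>finite S\<close> \<open>S \<noteq> {}\<close> by (auto simp: emeasure_count_space card_gt_0_iff ennreal_of_nat_eq_real_of_nat)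
  \<comment> \<open>Every function on a counting space is measurable. The two selected premises, the
    equation for \<open>p\<close> and \<open>\<epsilon> \<in> {0..p}\<close>, bound
    \<open>\<epsilon>\<close> by the probability of leaving the sublevel set.\<close>
  ultimately show ?case
    using prob_max_sampled_variance_ge[of "count_space S" J D Nv \<epsilon> "optimality_gap S J sstar"]
      1(11,12) assms(2) by simp
next
  case (2 S J m M s sstar D p \<epsilon>)
  have "finite D"
    using \<open>D \<subseteq> sampled_costs J Np s\<close> finite_sampled_costs finite_subset by blast
  \<comment> \<open>\<open>lborel\<close> and \<open>borel\<close> have the same measurable sets,
    and so do their restrictions to \<open>S\<close>.\<close>
  moreover have "J \<in> borel_measurable (restrict_space lborel S)"
    using \<open>J \<in> borel_measurable (restrict_space borel S)\<close>
    by (simp cong: measurable_cong_sets add: sets_restrict_space)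
  moreover have "space (restrict_space lborel S) = S"
    by (simp add: space_restrict_space)
  moreover have "emeasure (restrict_space lborel S) S = emeasure lborel S"
    using \<open>S \<in> sets borel\<close> by (simp add: emeasure_restrict_space)
  ultimately show ?case
    using prob_max_sampled_variance_ge
        [of "restrict_space lborel S" J D Nv \<epsilon> "optimality_gap S J sstar"]
      2(2,3,13,14) assms(2) by simp
qed

end
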